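(* Let $n$ be a positive integer, let $k=\lfloor n/3\rfloor$, and let $r\in\{0,1,2,3\}$ with $n\equiv r\pmod 4$. Let $$\mathcal{I}:=\Big[\,2n^2-n+66,\; k^2+\tfrac{(k-1)k(2k-1)}{3}-66\,\Big].$$ Then $\mathcal{I}\cap \mathrm{Set}_{\mathbb{Z}}(n)$ is an arithmetic progression of the form $\{4t+r\}$, i.e. it consists of the integers in $\mathcal{I}$ that are congruent to $r$ modulo $4$. Moreover, the set $$\mathcal{J}:=\mathrm{Set}_{\mathbb{Z}}(n)\cap\Big(k^2+\tfrac{(k-1)k(2k-1)}{3},\; \tfrac{n(n+1)(2n+1)}{3}\Big]$$ contains $\Omega(n^2)$ elements (i.e. at least $cn^2$ elements for some absolute constant $c>0$, for all sufficiently large $n$).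
   Context: For a finite set $A\subseteq\mathbb{Z}$, the additive energy is $E(A):=|\{(a_1,a_2,a_3,a_4)\in A^4:\ a_1+a_2=a_3+a_4\}|$. For a positive integer $n$, $\mathrm{Set}_{\mathbb{Z}}(n):=\{E(A):\ A\subseteq\mathbb{Z},\ |A|=n\}$. *)

theory Defs
  imports Complex_Main "HOL-Library.Landau_Symbols" "HOL-Number_Theory.Cong"
begin

definition additive_energy :: "int set \<Rightarrow> nat" where
  "additive_energy A =
     card {(a1, a2, a3, a4). a1 \<in> A \<and> a2 \<in> A \<and> a3 \<in> A \<and> a4 \<in> A \<and> a1 + a2 = a3 + a4}"

definition Set_Z :: "nat \<Rightarrow> nat set" where
  "Set_Z n = {additive_energy A | A. finite A \<and> card A = n}"

text \<open>
  The intervals are taken in the reals, so that neither the subtractions nor the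
  division by 3 are truncated; the first one is empty for small \<open>n\<close>.
\<close>

definition interval_I :: "nat \<Rightarrow> real set" where
  "interval_I n =
     (let k = real (n div 3) in
       {2 * real n ^ 2 - real n + 66 .. k ^ 2 + (k - 1) * k * (2 * k - 1) / 3 - 66})"

definition set_J :: "nat \<Rightarrow> real set" where
  "set_J n =
     (let k = real (n div 3) in
       real ` Set_Z n \<inter>
       {k ^ 2 + (k - 1) * k * (2 * k - 1) / 3 <.. real n * (real n + 1) * (2 * real n + 1) / 3})"

end

theory Submission
  imports Defs
begin

text \<open>If \<open>M\<close> denotes the sum of \<open>r(d) choose 2\<close> over \<open>d > 0\<close>, where \<open>r(d)\<close> is the number of
  representations of \<open>d\<close> as a difference in \<open>A\<close>, then \<open>E(A) = 2 * n^2 - n + 4 * M\<close>; hence the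
  congruence. A progression of length \<open>a\<close> has \<open>M = a choose 3\<close>, and adding a far away progression
  with a large common difference to a set creates no further coincidences, so that \<open>M\<close> is additive.
  It remains to write \<open>M\<close> as a sum of tetrahedral numbers \<open>a\<^sub>i choose 3\<close> with \<open>\<Sum>a\<^sub>i \<le> n\<close>.
  For \<open>M < k choose 3\<close> a greedy choice has total length at most \<open>3 * k + 8\<close>: after \<open>a < k\<close> the
  remainder is below \<open>a choose 2\<close>, hence below \<open>b choose 3\<close> for some \<open>b\<close> close to \<open>2 * a / 3\<close>, and
  \<open>a + 3 * b \<le> 3 * k\<close>. For \<open>k \<ge> 25\<close> the first step has enough room to absorb the 8, and for \<open>k < 25\<close>
  the interval is empty.
  Taking \<open>a = k\<close> first instead yields more than \<open>c * n^2\<close> energies above that of a progression of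
  length \<open>k\<close>.\<close>

section \<open>Energy under insertion of a new maximum, and its residue modulo 4\<close>

definition energy_quads :: "int set \<Rightarrow> (int \<times> int \<times> int \<times> int) set" where
  "energy_quads A =
     {(a1, a2, a3, a4). a1 \<in> A \<and> a2 \<in> A \<and> a3 \<in> A \<and> a4 \<in> A \<and> a1 + a2 = a3 + a4}"

lemma additive_energy_quads: "additive_energy A = card (energy_quads A)"
  by (simp add: additive_energy_def energy_quads_def)

lemma finite_energy_quads: "finite A \<Longrightarrow> finite (energy_quads A)"
  by (rule finite_subset[of _ "A \<times> A \<times> A \<times> A"]) (auto simp: energy_quads_def)

text \<open>These pairs encode the solutions of \<open>x + y = z + w\<close> with \<open>y\<close>,
  \<open>z\<close>, \<open>w\<close> in \<open>A\<close>; the entry \<open>y\<close> is determined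
  by the others.\<close>

definition sums_above :: "int set \<Rightarrow> int \<Rightarrow> (int \<times> int) set" where
  "sums_above A x = {(z, w). z \<in> A \<and> w \<in> A \<and> z + w - x \<in> A}"

lemma finite_sums_above: "finite A \<Longrightarrow> finite (sums_above A x)"
  by (rule finite_subset[of _ "A \<times> A"]) (auto simp: sums_above_def)

text \<open>A new quadruple either has \<open>x\<close> on both sides, so that cancelling leaves a
  trivial quadruple, or contains \<open>x\<close> exactly once, in one of four positions. Maximality
  rules out \<open>x + x\<close> against two smaller elements.\<close>

lemma additive_energy_insert_max:
  assumes fin: "finite A" and max: "\<And>a. a \<in> A \<Longrightarrow> a < x"
  shows "additive_energy (insert x A)
           = additive_energy A + 4 * card A + 1 + 4 * card (sums_above A x)"
proof -
  define P0 where "P0 = energy_quads A"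
  \<comment> \<open>Only \<open>P1\<close> ranges over \<open>insert x A\<close>, so
    \<open>(x, x, x, x)\<close> is counted once; this is the summand 1.\<close>
  define P1 where "P1 = (\<lambda>y. (x, y, x, y)) ` insert x A"
  define P2 where "P2 = (\<lambda>y. (x, y, y, x)) ` A"
  define P3 where "P3 = (\<lambda>y. (y, x, x, y)) ` A"
  define P4 where "P4 = (\<lambda>y. (y, x, y, x)) ` A"
  define U1 where "U1 = (\<lambda>(z, w). (x, z + w - x, z, w)) ` sums_above A x"
  define U2 where "U2 = (\<lambda>(z, w). (z + w - x, x, z, w)) ` sums_above A x"
  define U3 where "U3 = (\<lambda>(z, w). (z, w, x, z + w - x)) ` sums_above A x"
  define U4 where "U4 = (\<lambda>(z, w). (z, w, z + w - x, x)) ` sums_above A x"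
  note defs = P0_def P1_def P2_def P3_def P4_def U1_def U2_def U3_def U4_def
  have x: "x \<notin> A" using max by blast
  have fins: "finite P0" "finite P1" "finite P2" "finite P3" "finite P4"
      "finite U1" "finite U2" "finite U3" "finite U4"
    using fin finite_energy_quads[OF fin] finite_sums_above[OF fin] by (simp_all add: defs)
  have cards: "card P1 = card A + 1" "card P2 = card A" "card P3 = card A" "card P4 = card A"
      "card U1 = card (sums_above A x)" "card U2 = card (sums_above A x)"
      "card U3 = card (sums_above A x)" "card U4 = card (sums_above A x)"
    unfolding defs using x fin
    by (subst card_image; force simp: inj_on_def)+
  have "energy_quads (insert x A) = P0 \<union> P1 \<union> P2 \<union> P3 \<union> P4 \<union> U1 \<union> U2 \<union> U3 \<union> U4" (is "_ = ?R")
  proof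
    show "?R \<subseteq> energy_quads (insert x A)"
      by (auto simp: defs energy_quads_def sums_above_def)
    show "energy_quads (insert x A) \<subseteq> ?R"
    proof
      fix q assume "q \<in> energy_quads (insert x A)"
      then obtain a b c d where q: "q = (a, b, c, d)"
        and mem: "a \<in> insert x A" "b \<in> insert x A" "c \<in> insert x A" "d \<in> insert x A"
        and sum: "a + b = c + d"
        by (auto simp: energy_quads_def)
      have d: "d = a + b - c" and a: "a = c + d - b" and b: "b = c + d - a" and c: "c = a + b - d"
        using sum by auto
      have le: "a \<le> x" "b \<le> x" "c \<le> x" "d \<le> x" using mem max by force+
      consider "a = x" "c = x" | "a = x" "d = x" | "b = x" "c = x" | "b = x" "d = x"
        | "a = x" "b \<noteq> x" "c \<noteq> x" "d \<noteq> x" | "a \<noteq> x" "b = x" "c \<noteq> x" "d \<noteq> x"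
        | "a \<noteq> x" "b \<noteq> x" "c = x" "d \<noteq> x" | "a \<noteq> x" "b \<noteq> x" "c \<noteq> x" "d = x"
        | "a \<noteq> x" "b \<noteq> x" "c \<noteq> x" "d \<noteq> x"
        using sum le by linarith
      then show "q \<in> ?R"
      proof cases
        case 1
        then have "q \<in> P1" using q mem sum by (auto simp: defs)
        then show ?thesis by blast
      next
        case 2
        then have "q \<in> P1 \<union> P2" using q mem sum by (auto simp: defs)
        then show ?thesis by blast
      next
        case 3
        then have "q \<in> P1 \<union> P3" using q mem sum by (auto simp: defs)
        then show ?thesis by blast
      next
        case 4
        then have "q \<in> P1 \<union> P4" using q mem sum by (auto simp: defs)
        then show ?thesis by blast
      next
        case 5
        then have "(c, d) \<in> sums_above A x" "q = (\<lambda>(z, w). (x, z + w - x, z, w)) (c, d)"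
          using q mem b by (auto simp: sums_above_def)
        then show ?thesis unfolding U1_def by blast
      next
        case 6
        then have "(c, d) \<in> sums_above A x" "q = (\<lambda>(z, w). (z + w - x, x, z, w)) (c, d)"
          using q mem a by (auto simp: sums_above_def)
        then show ?thesis unfolding U2_def by blast
      next
        case 7
        then have "(a, b) \<in> sums_above A x" "q = (\<lambda>(z, w). (z, w, x, z + w - x)) (a, b)"
          using q mem d by (auto simp: sums_above_def)
        then show ?thesis unfolding U3_def by blast
      next
        case 8
        then have "(a, b) \<in> sums_above A x" "q = (\<lambda>(z, w). (z, w, z + w - x, x)) (a, b)"
          using q mem c by (auto simp: sums_above_def)
        then show ?thesis unfolding U4_def by blast
      next
        case 9
        then have "q \<in> P0" using q mem sum by (auto simp: defs energy_quads_def)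
        then show ?thesis by blast
      qed
    qed
  qed
  moreover have
    "P0 \<inter> P1 = {}"
    "(P0 \<union> P1) \<inter> P2 = {}"
    "(P0 \<union> P1 \<union> P2) \<inter> P3 = {}"
    "(P0 \<union> P1 \<union> P2 \<union> P3) \<inter> P4 = {}"
    "(P0 \<union> P1 \<union> P2 \<union> P3 \<union> P4) \<inter> U1 = {}"
    "(P0 \<union> P1 \<union> P2 \<union> P3 \<union> P4 \<union> U1) \<inter> U2 = {}"
    "(P0 \<union> P1 \<union> P2 \<union> P3 \<union> P4 \<union> U1 \<union> U2) \<inter> U3 = {}"
    "(P0 \<union> P1 \<union> P2 \<union> P3 \<union> P4 \<union> U1 \<union> U2 \<union> U3) \<inter> U4 = {}"
    using x by (auto simp: defs energy_quads_def sums_above_def)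
  ultimately have "card (energy_quads (insert x A)) = card P0 + card P1 + card P2 + card P3 + card P4
      + card U1 + card U2 + card U3 + card U4"
    using fins by (simp only: card_Un_disjoint finite_UnI)
  then show ?thesis
    unfolding additive_energy_quads by (simp add: cards P0_def)
qed

text \<open>Inserting the elements in increasing order, each one raises the energy by 1 modulo
  4.\<close>

lemma additive_energy_cong_card:
  assumes "finite A"
  shows "[additive_energy A = card A] (mod 4)"
  using assms
proof (induction rule: finite_linorder_max_induct)
  case empty
  then show ?case by (simp add: additive_energy_def case_prod_unfold)
next
  case (insert x A)
  then have "x \<notin> A" by auto
  moreover have "additive_energy (insert x A)
      = additive_energy A + 1 + 4 * (card A + card (sums_above A x))"
    using additive_energy_insert_max[of A x] insert by simp
  moreover have "[additive_energy A + 1 + 4 * (card A + card (sums_above A x)) = card A + 1 + 0] (mod 4)"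
    using insert by (intro cong_add cong_refl) (auto simp: cong_def)
  ultimately show ?case using insert by simp
qed

section \<open>Adding far away arithmetic progressions\<close>

text \<open>A Sidon set of size \<open>n\<close> has energy \<open>2 * n^2 - n\<close>, so \<open>M\<close> counts, up to the factor 4, the
  nontrivial additive quadruples.\<close>

definition realizable :: "nat \<Rightarrow> nat \<Rightarrow> bool" where
  "realizable n M \<longleftrightarrow>
     (\<exists>A. finite A \<and> card A = n \<and> additive_energy A + n = 2 * n\<^sup>2 + 4 * M)"

lemma realizable_0: "realizable 0 0"
  unfolding realizable_def by (intro exI[of _ "{}"]) (simp add: additive_energy_def case_prod_unfold)

text \<open>Appending the term of index \<open>i\<close> to a progression creates one nontrivial
  relation for each such pair, with third index \<open>j + l - i\<close>.\<close>

lemma card_pairs_sum_ge: "card {(j, l). j < i \<and> l < i \<and> i \<le> j + l} = (i choose 2)" for i :: nat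
proof -
  have "{(j, l). j < i \<and> l < i \<and> i \<le> j + l} = (SIGMA j:{..<i}. {i - j..<i})" by auto
  then have "card {(j, l). j < i \<and> l < i \<and> i \<le> j + l} = (\<Sum>j<i. card {i - j..<i})"
    by simp
  also have "\<dots> = (\<Sum>j<i. j)" by (intro sum.cong) auto
  also have "\<dots> = (i choose 2)"
    by (simp add: choose_two gauss_sum_nat lessThan_atLeast0 Sum_Ico_nat)
  finally show ?thesis .
qed

text \<open>The terms are inserted in increasing order. Only pairs of progression terms give new
  relations, \<open>i choose 2\<close> of them at index \<open>i\<close>, and these add up to
  \<open>m choose 3\<close>.\<close>

lemma realizable_add_AP:
  assumes "realizable n M"
  shows "realizable (n + m) (M + (m choose 3))"
proof -
  from assms obtain A where A: "finite A" "card A = n" "additive_energy A + n = 2 * n\<^sup>2 + 4 * M"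
    unfolding realizable_def by blast
  obtain N :: int where N: "\<And>a. a \<in> A \<Longrightarrow> \<bar>a\<bar> < N" "N > 0"
  proof -
    have "finite (abs ` A)" using A by simp
    then obtain u where "\<forall>y\<in>abs ` A. y \<le> u"
      using bdd_above_finite unfolding bdd_above_def by blast
    then show thesis using that[of "\<bar>u\<bar> + 1"] by fastforce
  qed
  \<comment> \<open>\<open>A\<close> lies strictly between \<open>-N\<close> and \<open>N\<close>.
    The difference \<open>2 * N\<close> pushes \<open>a + p j - p i\<close> with
    \<open>j < i\<close> below \<open>-N\<close>. The \<open>4 * N\<close> in \<open>L\<close> keeps
    the progression above \<open>A\<close>, and \<open>int m * D\<close> keeps
    \<open>p j + p l - p i\<close> above \<open>A\<close> even when
    \<open>j + l < i\<close>.\<close>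
  define D where "D = 2 * N"
  define L where "L = 4 * N + int m * D"
  define p where "p j = L + int j * D" for j
  have D: "D > 0" using N by (simp add: D_def)
  have p_inj: "p i = p j \<longleftrightarrow> i = j" and p_less: "p i < p j \<longleftrightarrow> i < j" for i j
    using D by (auto simp: p_def)
  have p_notin: "p j \<notin> A" for j
  proof
    assume "p j \<in> A"
    moreover have "p j \<ge> 4 * N" using D by (simp add: p_def L_def)
    ultimately show False using N by fastforce
  qed
  have "additive_energy (A \<union> p ` {..<i}) + (n + i) = 2 * (n + i)\<^sup>2 + 4 * (M + (i choose 3))"
    if "i \<le> m" for i
    using that
  proof (induction i)
    case 0
    then show ?case using A by simp
  next
    case (Suc i)
    let ?S = "A \<union> p ` {..<i}"
    have low: "a < p j" if "a \<in> A" for a j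
    proof -
      have "p j \<ge> 4 * N" using D by (simp add: p_def L_def)
      then show ?thesis using N(1)[OF that] N(2) by linarith
    qed
    have disj: "A \<inter> p ` {..<i} = {}" using p_notin by auto
    have card: "card ?S = n + i"
      using A disj p_inj by (simp add: card_Un_disjoint card_image inj_on_def)
    have "sums_above ?S (p i)
        = (\<lambda>(j, l). (p j, p l)) ` {(j, l). j < i \<and> l < i \<and> i \<le> j + l}" (is "_ = ?R")
    proof
      show "?R \<subseteq> sums_above ?S (p i)"
      proof
        fix q assume "q \<in> ?R"
        then obtain j l where q: "q = (p j, p l)" "j < i" "l < i" "i \<le> j + l" by auto
        then have "p j + p l - p i = p (j + l - i)" by (simp add: p_def of_nat_diff algebra_simps)
        then show "q \<in> sums_above ?S (p i)" using q by (auto simp: sums_above_def)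
      qed
      show "sums_above ?S (p i) \<subseteq> ?R"
      proof
        fix q assume "q \<in> sums_above ?S (p i)"
        then obtain z w where q: "q = (z, w)" "z \<in> ?S" "w \<in> ?S" "z + w - p i \<in> ?S"
          by (auto simp: sums_above_def)
        have p_ge: "4 * N \<le> p j" for j using D by (simp add: p_def L_def)
        have lowS: "- N < y" if y: "y \<in> ?S" for y
        proof (cases "y \<in> A")
          case True
          then show ?thesis using N(1)[of y] by linarith
        next
          case False
          then obtain j where "y = p j" using y by (elim UnE imageE) simp_all
          then show ?thesis using p_ge[of j] N(2) by linarith
        qed
        have mixed: False if a: "a \<in> A" and j: "j < i" and S: "a + p j - p i \<in> ?S" for a j
        proof -
          have "1 * D \<le> (int i - int j) * D" using j D by (intro mult_right_mono) auto
          then have "a + p j - p i < - N"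
            using N(1)[OF a] by (simp add: p_def D_def algebra_simps)
          then show False using lowS[OF S] by simp
        qed
        consider "z \<in> A" "w \<in> A" | j where "z \<in> A" "w = p j" "j < i"
          | j where "z = p j" "j < i" "w \<in> A" | j l where "z = p j" "w = p l" "j < i" "l < i"
          using q by blast
        then show "q \<in> ?R"
        proof cases
          case 1
          then have "z + w - p i < - N" using N(1)[of z] N(1)[of w] p_ge[of i] N(2) by linarith
          then show ?thesis using lowS[OF q(4)] by simp
        next
          case 2
          then show ?thesis using mixed[of z j] q by simp
        next
          case 3
          then show ?thesis using mixed[of w j] q by (simp add: add.commute)
        next
          case 4
          have eq: "z + w - p i = L + (int j + int l - int i) * D"
            by (simp add: 4 p_def algebra_simps)
          have "0 \<le> (int m - int i + int j + int l) * D" using Suc.prems D by simp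
          then have "4 * N \<le> z + w - p i" unfolding eq L_def by (simp add: algebra_simps)
          then have "z + w - p i \<notin> A" using N(1)[of "z + w - p i"] N(2) by auto
          \<comment> \<open>The value is above \<open>A\<close>, so it is a progression term; its
            index \<open>r\<close> is a natural number, which forces
            \<open>i \<le> j + l\<close>.\<close>
          then obtain r where r: "z + w - p i = p r" using q(4) by blast
          have "L + (int j + int l - int i) * D = p r" by (rule trans[OF eq[symmetric] r])
          then have "int j + int l - int i = int r" using D by (simp add: p_def)
          then have "i \<le> j + l" by linarith
          then show ?thesis using 4 q(1) by (intro image_eqI[of _ _ "(j, l)"]) auto
        qed
      qed
    qed
    then have "card (sums_above ?S (p i)) = (i choose 2)"
      using p_inj card_pairs_sum_ge[of i] by (simp add: card_image inj_on_def)
    moreover have "additive_energy (insert (p i) ?S)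
        = additive_energy ?S + 4 * card ?S + 1 + 4 * card (sums_above ?S (p i))"
      using A low p_less by (intro additive_energy_insert_max) auto
    moreover have "A \<union> p ` {..<Suc i} = insert (p i) ?S" by (auto simp: lessThan_Suc)
    moreover have "Suc i choose 3 = (i choose 3) + (i choose 2)"
      by (simp add: numeral_eq_Suc)
    \<comment> \<open>The increment \<open>4 * s + 1\<close> at \<open>s = n + i\<close> is exactly
      the growth of \<open>2 * s^2 - s\<close>; the rest goes into the tetrahedral number.\<close>
    ultimately show ?case using Suc card
      by (simp add: power2_eq_square algebra_simps)
  qed
  from this[of m] have "additive_energy (A \<union> p ` {..<m}) + (n + m)
      = 2 * (n + m)\<^sup>2 + 4 * (M + (m choose 3))" by simp
  moreover have "card (A \<union> p ` {..<m}) = n + m"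
    using A p_notin p_inj by (subst card_Un_disjoint) (auto simp: card_image inj_on_def)
  ultimately show ?thesis unfolding realizable_def using A by (intro exI[of _ "A \<union> p ` {..<m}"]) auto
qed

text \<open>A far away single point contributes \<open>1 choose 3 = 0\<close>, so spare elements can
  be used up freely.\<close>

lemma realizable_Suc: "realizable n M \<Longrightarrow> realizable (Suc n) M"
  using realizable_add_AP[of n M 1] by (simp add: binomial_eq_0)

lemma realizable_mono: "n \<le> n' \<Longrightarrow> realizable n M \<Longrightarrow> realizable n' M"
  by (induction rule: dec_induct) (auto intro: realizable_Suc)

section \<open>Short sums of tetrahedral numbers\<close>

text \<open>Progressions of lengths 5, 4, 3 contribute 10, 4, 1. Writing
  \<open>M = 10 * t + 4 * q + r\<close> costs \<open>5 * t + 4 * q + 3 * r\<close> elements; the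
  worst last digit is 7, with 13 elements, whence the 19.\<close>

lemma realizable_crude: "realizable ((M + 19) div 2) M"
proof -
  have three: "realizable (3 * s) s" for s
  proof (induction s)
    case (Suc s)
    show ?case using realizable_add_AP[OF Suc, of 3] by (simp add: algebra_simps)
  qed (simp add: realizable_0)
  have four: "realizable (n + 4 * q) (s + 4 * q)" if "realizable n s" for n q s
  proof (induction q)
    case (Suc q)
    show ?case using realizable_add_AP[OF Suc, of 4] by (simp add: numeral_eq_Suc algebra_simps)
  qed (use that in simp)
  have five: "realizable (n + 5 * q) (s + 10 * q)" if "realizable n s" for n q s
  proof (induction q)
    case (Suc q)
    show ?case using realizable_add_AP[OF Suc, of 5] by (simp add: numeral_eq_Suc algebra_simps)
  qed (use that in simp)
  define s t where "s = M mod 10" and "t = M div 10"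
  define q r where "q = s div 4" and "r = s mod 4"
  have s: "s = 4 * q + r" "r < 4" "s < 10" "M = s + 10 * t"
    by (simp_all add: s_def t_def q_def r_def)
  have "realizable (3 * r + 4 * q + 5 * t) M"
    using five[OF four[OF three], of r q t] s by (simp add: add.commute)
  moreover have "2 * (3 * r + 4 * q + 5 * t) \<le> M + 19"
  proof (cases "q \<le> 1")
    case True
    then show ?thesis using s by simp
  next
    case False
    then have "r \<le> 1" using s by simp
    then show ?thesis using s by simp
  qed
  then have "3 * r + 4 * q + 5 * t \<le> (M + 19) div 2"
    by (simp add: less_eq_div_iff_mult_less_eq)
  ultimately show ?thesis by (auto intro: realizable_mono[rotated])
qed

lemma choose_2_real: "2 * real (n choose 2) = real n * (real n - 1)"
  by (induction n) (simp_all add: numeral_eq_Suc algebra_simps)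

lemma choose_3_real: "6 * real (n choose 3) = real n * (real n - 1) * (real n - 2)"
proof (induction n)
  case (Suc n)
  have "Suc n choose 3 = (n choose 2) + (n choose 3)" by (simp add: numeral_eq_Suc)
  then show ?case using Suc choose_2_real[of n] by (simp add: algebra_simps)
qed simp

text \<open>A cubic in \<open>b\<close> beats a quadratic in \<open>a\<close> of size about
  \<open>3 * b / 2\<close>. The slack 10 later makes room for the additive 8. At
  \<open>b = 13\<close> the estimate with the real value \<open>a = (3 * b + 10) / 2\<close>
  fails.\<close>

lemma choose_2_le_choose_3:
  assumes "2 * a \<le> 3 * b + 10" "b \<ge> 14"
  shows "(a choose 2) \<le> (b choose 3)"
proof -
  define x y where "x = real a" and "y = real b"
  have xy: "x \<le> (3 * y + 10) / 2" "y \<ge> 14" "x \<ge> 0" using assms by (auto simp: x_def y_def)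
  have "3 * (x * (x - 1)) \<le> 3 * ((3 * y + 10) / 2 * ((3 * y + 10) / 2 - 1))"
  proof (cases "x \<ge> 1")
    case True
    then show ?thesis using xy by (intro mult_left_mono mult_mono) auto
  next
    case False
    then have "x * (x - 1) \<le> 0" using xy by (intro mult_nonneg_nonpos) auto
    moreover have "0 \<le> (3 * y + 10) / 2 * ((3 * y + 10) / 2 - 1)"
      using xy by (intro mult_nonneg_nonneg) auto
    ultimately show ?thesis by linarith
  qed
  also have "\<dots> \<le> y * (y - 1) * (y - 2)"
  proof -
    \<comment> \<open>With names for the square and the cube of \<open>y\<close>, the inequality is
      linear in \<open>y\<close>, \<open>q\<close>, \<open>c\<close>.\<close>
    define q c where "q = y * y" and "c = y * q"
    have "14 * y \<le> q" "14 * q \<le> c" using xy by (auto simp: q_def c_def intro!: mult_right_mono)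
    moreover have "3 * ((3 * y + 10) / 2 * ((3 * y + 10) / 2 - 1)) = (27 * q + 162 * y + 240) / 4"
      "y * (y - 1) * (y - 2) = c - 3 * q + 2 * y"
      by (simp_all add: q_def c_def field_simps)
    ultimately show ?thesis using xy(2) by argo
  qed
  finally have "6 * real (a choose 2) \<le> 6 * real (b choose 3)"
    using choose_2_real[of a] choose_3_real[of b] by (simp add: x_def y_def)
  then show ?thesis by linarith
qed

text \<open>One greedy step: \<open>a\<close> indexes the largest tetrahedral number not exceeding
  \<open>M\<close>, and the gap to the next one is \<open>a choose 2\<close> by Pascal's
  rule.\<close>

lemma choose_3_bracket:
  assumes "M < (k choose 3)"
  obtains a where "a < k" "(a choose 3) \<le> M" "M - (a choose 3) < (a choose 2)"
proof -
  define b where "b = (LEAST b. M < (b choose 3))"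
  have b: "M < (b choose 3)" "b \<le> k"
    using assms unfolding b_def by (auto intro: LeastI Least_le)
  then obtain a where a: "b = Suc a" by (cases b) (auto simp: binomial_eq_0)
  then have "\<not> M < (a choose 3)" unfolding b_def using not_less_Least by (metis lessI)
  moreover have "Suc a choose 3 = (a choose 2) + (a choose 3)" by (simp add: numeral_eq_Suc)
  ultimately show thesis using b a by (intro that[of a]) auto
qed

lemma realizable_split:
  assumes "(a choose 3) \<le> M" "realizable n (M - (a choose 3))" "n + a \<le> n'"
  shows "realizable n' M"
  using realizable_add_AP[OF assms(2), of a] assms by (auto intro: realizable_mono)

text \<open>Greedy recursion: spending \<open>a\<close> leaves a problem of parameter
  \<open>b\<close> with \<open>a + 3 * b \<le> 3 * k\<close>, so the additive 8 never grows and is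
  paid only at the end, by the crude bound.\<close>

lemma realizable_linear:
  assumes "M < (k choose 3)"
  shows "realizable (3 * k + 8) M"
  using assms
proof (induction k arbitrary: M rule: less_induct)
  case (less k)
  obtain a where a: "a < k" "(a choose 3) \<le> M" "M - (a choose 3) < (a choose 2)"
    using choose_3_bracket[OF less.prems] .
  show ?case
  proof (cases "a \<le> 10")
    case True
    then have "a * (a - 1) \<le> a * 9" by (intro mult_left_mono) auto
    moreover have "2 * (a choose 2) \<le> a * (a - 1)" by (simp add: choose_two)
    ultimately have C: "2 * (a choose 2) \<le> 9 * a" by linarith
    define R where "R = M - (a choose 3)"
    \<comment> \<open>Equality occurs at \<open>a = 10\<close>, \<open>R = 44\<close>,
      \<open>k = 11\<close>; this fixes the constant 8.\<close>
    have "R + 2 * a + 19 \<le> 6 * k + 17"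
      using C a(1,3) True unfolding R_def by linarith
    then have "(R + 19) div 2 + a \<le> 3 * k + 8" by linarith
    then show ?thesis unfolding R_def by (rule realizable_split[OF a(2) realizable_crude])
  next
    case False
    \<comment> \<open>This \<open>b\<close> first suffices at \<open>a = 11\<close>, where 55 is
      compared with 56; at \<open>a = 10\<close> it would be 45 against 35. For
      \<open>a < 20\<close> it is below 14, so those cases are computed.\<close>
    define b where "b = (2 * a + 3) div 3"
    have b: "b < k" "a + 3 * b \<le> 3 * k" using False a unfolding b_def by auto
    have "(a choose 2) \<le> (b choose 3)"
    proof (cases "a < 20")
      case True
      then consider "a = 11" | "a = 12" | "a = 13" | "a = 14" | "a = 15" | "a = 16" | "a = 17"
        | "a = 18" | "a = 19"
        using False by linarith
      then have "6 * real (a choose 2) \<le> 6 * real (b choose 3)"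
        unfolding choose_3_real using choose_2_real[of a] by cases (simp_all add: b_def)
      then show ?thesis by simp
    next
      case False
      then show ?thesis by (intro choose_2_le_choose_3) (auto simp: b_def)
    qed
    then have "realizable (3 * b + 8) (M - (a choose 3))"
      using a b by (intro less.IH) auto
    then show ?thesis using realizable_split[OF a(2)] b by simp
  qed
qed

text \<open>In the first step a smaller \<open>b\<close> is affordable, and it saves the 8 elements
  that the recursion costs.\<close>

lemma realizable_3k:
  assumes "M < (k choose 3)" "k \<ge> 25"
  shows "realizable (3 * k) M"
proof -
  obtain a where a: "a < k" "(a choose 3) \<le> M" "M - (a choose 3) < (a choose 2)"
    using choose_3_bracket[OF assms(1)] .
  obtain b where "(a choose 2) \<le> (b choose 3)" "a + 3 * b + 8 \<le> 3 * k"
  proof (cases "a \<le> 24")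
    case True
    have "(a choose 2) \<le> (24 choose 2)" using True by (rule binomial_right_mono)
    also have "\<dots> \<le> (13 choose 3)"
      using choose_3_real[of 13] by (simp add: choose_two)
    \<comment> \<open>Here 276 is compared with 286, and the cost is at most
      \<open>24 + 39 + 8 = 71\<close>.\<close>
    finally show ?thesis using that[of 13] True assms by simp
  next
    case False
    then show ?thesis
      using a by (intro that[of "(2 * a - 5) div 3"] choose_2_le_choose_3) auto
  qed
  then show ?thesis
    using a realizable_split[OF a(2) realizable_linear[of _ b]] by simp
qed

lemma realizable_3k_large:
  assumes "M < (k choose 2)" "k \<ge> 25"
  shows "realizable (3 * k) ((k choose 3) + M)"
proof -
  \<comment> \<open>The 8 is subtracted so that \<open>3 * b + 8 + k \<le> 3 * k\<close>, while
    \<open>k \<ge> 25\<close> gives \<open>b \<ge> 14\<close>.\<close>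
  define b where "b = (2 * k - 8) div 3"
  have "(k choose 2) \<le> (b choose 3)"
    using assms by (intro choose_2_le_choose_3) (auto simp: b_def)
  then have "realizable (3 * b + 8) M" using assms by (intro realizable_linear) auto
  from realizable_add_AP[OF this, of k] have "realizable (3 * b + 8 + k) ((k choose 3) + M)"
    by (simp add: add.commute)
  then show ?thesis by (rule realizable_mono[rotated]) (use assms in \<open>auto simp: b_def\<close>)
qed

section \<open>Energies in the two intervals\<close>

lemma realizable_Set_Z:
  "realizable n M \<Longrightarrow> real (2 * n\<^sup>2 + 4 * M) - real n \<in> real ` Set_Z n"
  unfolding realizable_def Set_Z_def
  by (smt (verit) image_eqI mem_Collect_eq of_nat_add)

lemma Set_Z_cong: "e \<in> Set_Z n \<Longrightarrow> [e = n] (mod 4)"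
  using additive_energy_cong_card by (auto simp: Set_Z_def)

text \<open>Writing \<open>x = 2 * n^2 - n + 4 * u\<close>, the lower end gives
  \<open>u \<ge> 0\<close> and the upper end, below the energy of a \<open>k\<close>-term
  progression, gives \<open>u < (k choose 3)\<close>.\<close>

lemma interval_I_realizable:
  assumes "x \<in> interval_I n" "x = real_of_int (4 * t + int r)" "[n = r] (mod 4)"
  shows "x \<in> real ` Set_Z n"
proof -
  define k where "k = n div 3"
  define y where "y = real k"
  have n: "3 * y \<le> real n" "0 \<le> y" "3 * k \<le> n" unfolding k_def y_def by auto
  have lo: "2 * real n ^ 2 - real n + 66 \<le> x"
    and hi: "x \<le> y ^ 2 + (y - 1) * y * (2 * y - 1) / 3 - 66"
    using assms(1) by (auto simp: interval_I_def Let_def k_def y_def)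
  have mono: "18 * y ^ 2 - 3 * y \<le> 2 * real n ^ 2 - real n"
  proof -
    \<comment> \<open>The second factor below is negative only for \<open>n = 0\<close>, where the
      first one vanishes.\<close>
    have "n = 3 * k \<or> n \<ge> 1" using n by auto
    then have "0 \<le> (real n - 3 * y) * (2 * (real n + 3 * y) - 1)"
      using n by (auto simp: y_def)
    then show ?thesis by (simp add: power2_eq_square algebra_simps)
  qed
  have k: "k \<ge> 25"
  proof (rule ccontr)
    assume "\<not> k \<ge> 25"
    then have "y \<le> 24" by (simp add: y_def)
    define p q where "p = y ^ 2" and "q = y * p"
    have "q \<le> 24 * p" unfolding q_def using \<open>y \<le> 24\<close> by (intro mult_right_mono) (auto simp: p_def)
    moreover have "x \<le> (2 * q + y) / 3 - 66"
      using hi by (simp add: p_def q_def power2_eq_square field_simps)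
    moreover have "p \<ge> 0" by (simp add: p_def)
    \<comment> \<open>The two margins of 66 outweigh the linear terms, which amount to at most
      80.\<close>
    ultimately show False using lo mono \<open>y \<le> 24\<close> unfolding p_def[symmetric] by argo
  qed
  have "4 dvd (4 * t + int r - (2 * (int n)\<^sup>2 - int n))"
  proof -
    have "[int r = int n] (mod 4)"
      using assms(3) cong_int_iff[of n r 4] by (simp add: cong_sym)
    then obtain v where v: "int n = int r + 4 * v" by (auto simp: cong_iff_lin)
    \<comment> \<open>Since \<open>2 * n^2 - n = n + 2 * n * (n - 1)\<close>, it is congruent to
      \<open>n\<close> modulo 4.\<close>
    have "even (int n * (int n - 1))" by auto
    then obtain w where "int n * (int n - 1) = 2 * w" by (elim evenE)
    then have "4 * t + int r - (2 * (int n)\<^sup>2 - int n) = 4 * (t - v - w)"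
      using v by (simp add: power2_eq_square algebra_simps)
    then show ?thesis by (rule dvdI)
  qed
  then obtain u where u: "4 * t + int r = 2 * (int n)\<^sup>2 - int n + 4 * u"
    by (metis add.commute diff_add_cancel dvdE)
  then have x: "x = 2 * real n ^ 2 - real n + 4 * real_of_int u"
    using assms(2) by (metis (mono_tags) of_int_add of_int_diff of_int_mult of_int_numeral of_int_of_nat_eq of_int_power)
  then have "u \<ge> 0" using lo by linarith
  then have x': "x = 2 * real n ^ 2 - real n + 4 * real (nat u)" using x by simp
  have "4 * real (nat u) < 4 * real (k choose 3)"
  proof -
    have "y ^ 2 + (y - 1) * y * (2 * y - 1) / 3 = 2 * y ^ 2 - y + 4 * real (k choose 3)"
      using choose_3_real[of k] by (simp add: y_def power2_eq_square field_simps)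
    moreover have "1 * y \<le> y ^ 2"
      unfolding power2_eq_square using k by (intro mult_right_mono) (auto simp: y_def)
    ultimately show ?thesis using hi mono n(2) unfolding x' by argo
  qed
  then have "realizable (3 * k) (nat u)" using k by (intro realizable_3k) auto
  then have "realizable n (nat u)" using n by (auto intro: realizable_mono)
  from realizable_Set_Z[OF this] show ?thesis unfolding x' by (simp add: algebra_simps)
qed

text \<open>Each \<open>M < (k choose 2)\<close> yields its own energy \<open>f M\<close>. It
  exceeds the lower end, the energy of a \<open>k\<close>-term progression, because the quadratic
  part is taken at \<open>n \<ge> 3 * k\<close> instead of \<open>k\<close>.\<close>

lemma card_set_J_ge:
  assumes "n div 3 \<ge> 25"
  shows "card (set_J n) \<ge> (n div 3 choose 2)"
proof -
  define k where "k = n div 3"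
  define y where "y = real k"
  define f where "f M = real (2 * n\<^sup>2 + 4 * ((k choose 3) + M)) - real n" for M
  have n: "3 * y \<le> real n" "0 \<le> y" "3 * k \<le> n" unfolding k_def y_def by auto
  have y: "y \<ge> 25" using assms by (simp add: y_def k_def)
  then have yy: "25 * y \<le> y ^ 2" unfolding power2_eq_square by (intro mult_right_mono) auto
  have mono: "18 * y ^ 2 - 3 * y \<le> 2 * real n ^ 2 - real n"
  proof -
    have "n = 3 * k \<or> n \<ge> 1" using n by auto
    then have "0 \<le> (real n - 3 * y) * (2 * (real n + 3 * y) - 1)"
      using n by (auto simp: y_def)
    then show ?thesis by (simp add: power2_eq_square algebra_simps)
  qed
  have "f ` {..<k choose 2} \<subseteq> set_J n"
  proof safe
    fix M assume M: "M < (k choose 2)"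
    have "realizable n ((k choose 3) + M)"
      using realizable_3k_large[OF M] assms n realizable_mono k_def by blast
    then have "f M \<in> real ` Set_Z n" unfolding f_def by (rule realizable_Set_Z)
    moreover have "y ^ 2 + (y - 1) * y * (2 * y - 1) / 3 < f M"
    proof -
      have "y ^ 2 + (y - 1) * y * (2 * y - 1) / 3 = 2 * y ^ 2 - y + 4 * real (k choose 3)"
        using choose_3_real[of k] by (simp add: y_def power2_eq_square field_simps)
      moreover have "f M = 2 * real n ^ 2 - real n + 4 * real (k choose 3) + 4 * real M"
        by (simp add: f_def)
      ultimately show ?thesis using mono y yy by linarith
    qed
    moreover have "f M \<le> real n * (real n + 1) * (2 * real n + 1) / 3"
    proof -
      define p q z where "p = real n ^ 2" and "q = real n ^ 3" and "z = y ^ 3"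
      have "q = real n * p" by (simp add: p_def q_def power2_eq_square power3_eq_cube)
      then have "75 * p \<le> q" using n y by (auto simp: p_def intro!: mult_right_mono)
      moreover have "27 * z \<le> q"
        using power_mono[OF n(1), of 3] n(2) by (simp add: q_def z_def)
      moreover have "real M \<le> real (k choose 2)" using M by simp
      \<comment> \<open>By Pascal's rule this is six times \<open>Suc k choose 3\<close>, at most
        \<open>n^3 / 27\<close>, which leaves ample room below the upper end.\<close>
      moreover have "6 * real (k choose 3) + 6 * real (k choose 2) = z - y"
        unfolding choose_3_real using choose_2_real[of k]
        by (simp add: y_def z_def power3_eq_cube algebra_simps)
      moreover have "f M = 2 * p - real n + 4 * real (k choose 3) + 4 * real M"
        by (simp add: f_def p_def)
      moreover have "p \<ge> 0" by (simp add: p_def)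
      ultimately have "f M \<le> (2 * q + 3 * p + real n) / 3" using y n(1) by argo
      also have "\<dots> = real n * (real n + 1) * (2 * real n + 1) / 3"
        by (simp add: p_def q_def power2_eq_square power3_eq_cube algebra_simps)
      finally show ?thesis .
    qed
    ultimately show "f M \<in> set_J n"
      by (simp add: set_J_def Let_def y_def k_def)
  qed
  \<comment> \<open>An infinite set has \<open>card\<close> 0, so the lower bound needs finiteness;
    the upper end supplies it.\<close>
  moreover have "finite (set_J n)"
  proof (rule finite_subset)
    show "set_J n \<subseteq> real ` {e. real e \<le> real n * (real n + 1) * (2 * real n + 1) / 3}"
      by (auto simp: set_J_def Let_def)
    show "finite (real ` {e. real e \<le> real n * (real n + 1) * (2 * real n + 1) / 3})"
      by (intro finite_imageI finite_subset[OF _ finite_atMost[of "nat \<lceil>real n * (real n + 1) * (2 * real n + 1) / 3\<rceil>"]])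
         (auto simp: le_nat_iff ceiling_mono, linarith)
  qed
  ultimately have "card (f ` {..<k choose 2}) \<le> card (set_J n)" by (rule card_mono[rotated])
  moreover have "inj f" by (auto simp: inj_def f_def)
  ultimately show ?thesis by (simp add: card_image k_def inj_on_def)
qed

theorem theorem2p1:
  "(\<forall>n r :: nat. n > 0 \<longrightarrow> r \<in> {0, 1, 2, 3} \<longrightarrow> [n = r] (mod 4) \<longrightarrow>
      interval_I n \<inter> real ` Set_Z n =
        {x \<in> interval_I n. \<exists>t :: int. x = real_of_int (4 * t + int r)})
   \<and> (\<lambda>n. real (card (set_J n))) \<in> \<Omega>(\<lambda>n. real n ^ 2)"
proof (intro conjI allI impI)
  fix n r :: nat
  assume nr: "[n = r] (mod 4)"
  show "interval_I n \<inter> real ` Set_Z n =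
        {x \<in> interval_I n. \<exists>t :: int. x = real_of_int (4 * t + int r)}"
  proof safe
    fix e assume "e \<in> Set_Z n"
    then have "[e = r] (mod 4)" using Set_Z_cong nr cong_trans by blast
    then have "[int r = int e] (mod 4)" 
      using cong_int_iff[of e r 4] by (simp add: cong_sym)
    then obtain t where t: "int e = int r + 4 * t" by (auto simp: cong_iff_lin)
    have "real e = real_of_int (int e)" by simp
    also have "\<dots> = real_of_int (4 * t + int r)" unfolding t by simp
    finally have "real e = real_of_int (4 * t + int r)" .
    then show "\<exists>t. real e = real_of_int (4 * t + int r)" by blast
  next
    fix x t assume "real_of_int (4 * t + int r) \<in> interval_I n"
    then show "real_of_int (4 * t + int r) \<in> real ` Set_Z n"
      by (rule interval_I_realizable[OF _ refl nr])
  qed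
next
  show "(\<lambda>n. real (card (set_J n))) \<in> \<Omega>(\<lambda>n. real n ^ 2)"
  \<comment> \<open>Asymptotically \<open>n^2\<close> is \<open>9 * k^2\<close> and
    \<open>k choose 2\<close> is \<open>k^2 / 2\<close>, a ratio of 18; the constant 25 is enough
    from \<open>n = 75\<close> on, where \<open>k \<ge> 25\<close>.\<close>
  proof (rule landau_omega.bigI[of "1/25"])
    show "\<forall>\<^sub>F n in at_top. 1 / 25 * norm (real n ^ 2) \<le> norm (real (card (set_J n)))"
      using eventually_ge_at_top[of 75]
    proof eventually_elim
      case (elim n)
      define k where "k = n div 3"
      define y where "y = real k"
      have k: "k \<ge> 25" using elim by (simp add: k_def)
      then have y: "real n \<le> 3 * y + 2" "y \<ge> 25" unfolding k_def y_def by auto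
      have "real n ^ 2 \<le> (3 * y + 2) ^ 2" using y by (intro power_mono) auto
      also have "\<dots> \<le> 25 * (y * (y - 1) / 2)"
      proof -
        define p where "p = y ^ 2"
        have "25 * y \<le> p" using y unfolding p_def power2_eq_square by (intro mult_right_mono) auto
        then have "9 * p + 12 * y + 4 \<le> 25 * (p - y) / 2" using y by argo
        also have "\<dots> = 25 * (y * (y - 1) / 2)" by (simp add: p_def power2_eq_square field_simps)
        finally show ?thesis by (simp add: p_def power2_eq_square algebra_simps)
      qed
      also have "\<dots> = 25 * real (k choose 2)" using choose_2_real[of k] by (simp add: y_def)
      also have "\<dots> \<le> 25 * real (card (set_J n))"
        using card_set_J_ge[of n] k by (simp add: k_def)
      finally show ?case by simp
    qed
  qed simp
qed

end
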